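(* Let $\mathfrak{g}$ be a strictly $B(0,1)$-graded Lie superalgebra over $\mathbb{F}$, decomposed as $\mathfrak{g}=(\mathfrak{b}\otimes\mathcal{A})\oplus(\mathfrak{s}\otimes\mathcal{B})\oplus\mathcal{D}$. Consider the $5$-grading $\mathfrak{g}=\bigoplus_{i=-2}^2\mathfrak{g}_i$ given by the action of the element $H$ (identified with $H\otimes1$). Then the element $e=X\otimes 1$ is a left unit of the $(-1,-1)$ Freudenthal-Kantor triple system $(U=\mathfrak{g}_1,xyz)$, where $xyz=[[x,\Phi(y)],z]$, and it satisfies $exe=x$ for any $x\in U$.
   Context: $\mathbb{F}$ is a field of characteristic not two or three. A triple system is an $\mathbb{F}$-vector space with a trilinear product $xyz$. A $(-1,-1)$ Freudenthal-Kantor triple system is a triple system $U$ such that, with $L(x,y)z=xyz$ and $K(x,y)z=xzy+yzx$, for all $u,v,x,y\in U$: $[L(u,v),L(x,y)]=L(uvx,y)-L(x,vuy)$ and $K(K(u,v)x,y)=L(y,x)K(u,v)+K(u,v)L(x,y)$. An element $e$ is a left unit if $eex=x$ for all $x\in U$. Let $\mathfrak{gl}(1,2)$ be the general linear Lie superalgebra of $3\times3$ matrices, with matrix units $E_{ij}$, where index $1$ is of one parity and indices $2,3$ of the other. Let $\mathfrak{b}\cong\mathfrak{osp}(1,2)=B(0,1)$ be its subalgebra with even basis $H=E_{22}-E_{33}$, $E=E_{23}$, $F=E_{32}$ and odd basis $X=E_{21}-E_{13}$, $Y=E_{12}+E_{31}$. Let $\mathfrak{s}\subset\mathfrak{gl}(1,2)$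 be the subspace with basis $\hat H=2E_{11}+E_{22}+E_{33}$ (even), $\hat X=E_{13}+E_{21}$, $\hat Y=-E_{12}+E_{31}$ (odd); it is a $\mathfrak{b}$-submodule of $\mathfrak{gl}(1,2)$, isomorphic to the natural three-dimensional module. A Lie superalgebra is $B(0,1)$-graded if it contains a subalgebra isomorphic to $\mathfrak{b}$ such that, as a module for it, it is a direct sum of copies of the adjoint module $\mathfrak{b}$ or this module with the parity changed, plus copies of the natural module $\mathfrak{s}$ or this module with the parity changed, plus a submodule with trivial action. It is strictly $B(0,1)$-graded if no parity-changed copies of the adjoint and natural modules appear. Such a $\mathfrak{g}$ decomposes, up to isomorphism, as $\mathfrak{g}=(\mathfrak{b}\otimes\mathcal{A})\oplus(\mathfrak{s}\otimes\mathcal{B})\oplus\mathcal{D}$ with $\mathcal{A},\mathcal{B}$ vector spaces (purely even in the strict case), where the chosen copy of $\mathfrak{b}$ is $\mathfrak{b}\otimes1$ for a distinguished element $1\in\mathcal{A}$, $[Z\otimes1,M\otimes a]=[Z,M]\otimes a$ for $Z\in\mathfrak{b}$ and $M\otimes a$ in $\mathfrak{b}\otimes\mathcal{A}$ or $\mathfrak{s}\otimes\mathcal{B}$ (bracket $[Z,M]$ in $\mathfrak{gl}(1,2)$), and $\mathcal{D}$ is the centralizer of $\mathfrak{b}\otimes1$. Put $\mathfrak{g}_i=\{Z\in\mathfrak{g}:[H\otimes1,Z]=iZ\}$, $i\in\{0,\pm1,\pm2\}$; in particular $\mathfrak{g}_1=(X\otimes\mathcal{A})\oplus(\hat X\otimes\mathcal{B})$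 and $\mathfrak{g}_{-1}=(Y\otimes\mathcal{A})\oplus(\hat Y\otimes\mathcal{B})$. Let $\Phi$ be the automorphism of $\mathfrak{gl}(1,2)$ given by conjugation by the matrix $\begin{pmatrix}1&0&0\\0&0&-1\\0&1&0\end{pmatrix}$; it preserves $\mathfrak{b}$ and $\mathfrak{s}$ and satisfies $\Phi(X)=Y$, $\Phi(\hat X)=\hat Y$. It extends to an automorphism of $\mathfrak{g}$, also denoted $\Phi$, by $\Phi(M\otimes a)=\Phi(M)\otimes a$ on $\mathfrak{b}\otimes\mathcal{A}$ and $\mathfrak{s}\otimes\mathcal{B}$, and $\Phi|_{\mathcal{D}}=\mathrm{id}$. With the triple product $xyz=[[x,\Phi(y)],z]$, $\mathfrak{g}_1$ is a $(-1,-1)$ Freudenthal-Kantor triple system. *)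

theory Defs
  imports "HOL-Analysis.Analysis" "HOL-Library.Z2"
begin

text \<open>Linearity of a map on a subspace only; outside the subspace the map is arbitrary.\<close>

definition linear_on ::
  "'v set \<Rightarrow> ('f::field \<Rightarrow> 'v::ab_group_add \<Rightarrow> 'v) \<Rightarrow> ('f \<Rightarrow> 'w::ab_group_add \<Rightarrow> 'w) \<Rightarrow> ('v \<Rightarrow> 'w) \<Rightarrow> bool"
  where "linear_on V s1 s2 f \<longleftrightarrow>
    (\<forall>x\<in>V. \<forall>y\<in>V. f (x + y) = f x + f y) \<and> (\<forall>c. \<forall>x\<in>V. f (s1 c x) = s2 c (f x))"

definition internal_direct_sum ::
  "('f::field \<Rightarrow> 'v::ab_group_add \<Rightarrow> 'v) \<Rightarrow> 'v set set \<Rightarrow> bool"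
  where "internal_direct_sum s \<W> \<longleftrightarrow>
    (\<forall>W\<in>\<W>. module.subspace s W) \<and>
    module.span s (\<Union>\<W>) = UNIV \<and>
    (\<forall>\<F> v. finite \<F> \<and> \<F> \<subseteq> \<W> \<and> (\<forall>W\<in>\<F>. v W \<in> W) \<and> (\<Sum>W\<in>\<F>. v W) = 0
       \<longrightarrow> (\<forall>W\<in>\<F>. v W = 0))"


section \<open>Lie superalgebras\<close>

text \<open>Parities are elements of the two-element field; \<open>koszul p q\<close> is $(-1)^{pq}$.\<close>

definition koszul :: "bit \<Rightarrow> bit \<Rightarrow> 'f::field"
  where "koszul p q = (if p = 1 \<and> q = 1 then -1 else 1)"

text \<open>Used in characteristic other than two and three, where super skew-symmetry and the super
  Jacobi identity need no supplementary axioms.\<close>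

locale lie_superalgebra = vector_space scale
  for scale :: "'f::field \<Rightarrow> 'g::ab_group_add \<Rightarrow> 'g" +
  fixes gr :: "bit \<Rightarrow> 'g set"
    and br :: "'g \<Rightarrow> 'g \<Rightarrow> 'g"
  assumes subspace_gr: "subspace (gr p)"
    and gr_inter: "gr 0 \<inter> gr 1 = {0}"
    and gr_sum: "\<exists>x0\<in>gr 0. \<exists>x1\<in>gr 1. x = x0 + x1"
    and linear_br_left: "Vector_Spaces.linear scale scale (\<lambda>x. br x y)"
    and linear_br_right: "Vector_Spaces.linear scale scale (br x)"
    and br_gr: "\<lbrakk>x \<in> gr p; y \<in> gr q\<rbrakk> \<Longrightarrow> br x y \<in> gr (p + q)"
    and br_super_skew: "\<lbrakk>x \<in> gr p; y \<in> gr q\<rbrakk> \<Longrightarrow> br x y = - scale (koszul p q) (br y x)"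
    and br_super_jacobi: "\<lbrakk>x \<in> gr p; y \<in> gr q\<rbrakk> \<Longrightarrow>
          br x (br y z) = br (br x y) z + scale (koszul p q) (br y (br x z))"


section \<open>The Lie superalgebra $\mathfrak{gl}(1,2)$\<close>

text \<open>Entrywise scaling of a 3 by 3 matrix; \<open>mscale (*)\<close> is the scalar multiplication of
  matrices over the ground field.\<close>

definition mscale :: "('f \<Rightarrow> 'a \<Rightarrow> 'a) \<Rightarrow> 'f \<Rightarrow> 'a^3^3 \<Rightarrow> 'a^3^3"
  where "mscale s c M = (\<chi> i j. s c (M $ i $ j))"

definition mat_unit :: "3 \<Rightarrow> 3 \<Rightarrow> 'f::field^3^3"
  where "mat_unit i j = axis i (axis j 1)"

definition index_parity :: "3 \<Rightarrow> bit"
  where "index_parity i = (if i = 1 then 0 else 1)"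

definition gl_part :: "bit \<Rightarrow> 'f::field^3^3 \<Rightarrow> 'f^3^3"
  where "gl_part p M = (\<chi> i j. if index_parity i + index_parity j = p then M $ i $ j else 0)"

definition gl_gr :: "bit \<Rightarrow> ('f::field^3^3) set"
  where "gl_gr p = {M. gl_part p M = M}"

text \<open>The supercommutator, extended bilinearly from homogeneous matrices.\<close>

definition gl_bracket :: "'f::field^3^3 \<Rightarrow> 'f^3^3 \<Rightarrow> 'f^3^3"
  where "gl_bracket M N = (\<Sum>p\<in>{0,1}. \<Sum>q\<in>{0,1}.
    gl_part p M ** gl_part q N - mscale (*) (koszul p q) (gl_part q N ** gl_part p M))"

definition mat_H :: "'f::field^3^3" where "mat_H = mat_unit 2 2 - mat_unit 3 3"
definition mat_E :: "'f::field^3^3" where "mat_E = mat_unit 2 3"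
definition mat_F :: "'f::field^3^3" where "mat_F = mat_unit 3 2"
definition mat_X :: "'f::field^3^3" where "mat_X = mat_unit 2 1 - mat_unit 1 3"
definition mat_Y :: "'f::field^3^3" where "mat_Y = mat_unit 1 2 + mat_unit 3 1"

definition mat_Hhat :: "'f::field^3^3"
  where "mat_Hhat = mscale (*) 2 (mat_unit 1 1) + mat_unit 2 2 + mat_unit 3 3"
definition mat_Xhat :: "'f::field^3^3" where "mat_Xhat = mat_unit 1 3 + mat_unit 2 1"
definition mat_Yhat :: "'f::field^3^3" where "mat_Yhat = - mat_unit 1 2 + mat_unit 3 1"

definition \<bb> :: "('f::field^3^3) set"
  where "\<bb> = module.span (mscale (*)) {mat_H, mat_E, mat_F, mat_X, mat_Y}"

definition \<ss> :: "('f::field^3^3) set"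
  where "\<ss> = module.span (mscale (*)) {mat_Hhat, mat_Xhat, mat_Yhat}"

definition Phi_mat :: "'f::field^3^3"
  where "Phi_mat = vector [vector [1, 0, 0], vector [0, 0, -1], vector [0, 1, 0]]"

definition Phi_gl :: "'f::field^3^3 \<Rightarrow> 'f^3^3"
  where "Phi_gl M = Phi_mat ** M ** matrix_inv Phi_mat"


section \<open>Strictly $B(0,1)$-graded Lie superalgebras\<close>

context lie_superalgebra
begin

text \<open>\<open>emb\<close> identifies \<open>\<bb>\<close> with a subalgebra.\<close>

definition osp_embedding :: "('f^3^3 \<Rightarrow> 'g) \<Rightarrow> bool"
  where "osp_embedding emb \<longleftrightarrow>
    linear_on \<bb> (mscale (*)) scale emb \<and> inj_on emb \<bb> \<and>
    (\<forall>p. \<forall>Z\<in>\<bb> \<inter> gl_gr p. emb Z \<in> gr p) \<and>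
    (\<forall>Z\<in>\<bb>. \<forall>Z'\<in>\<bb>. emb (gl_bracket Z Z') = br (emb Z) (emb Z'))"

text \<open>\<open>V\<close> is a submodule isomorphic, by an even (parity-preserving) isomorphism, to the
  \<open>\<bb>\<close>-submodule \<open>S\<close> of $\mathfrak{gl}(1,2)$. The adjoint module is \<open>S = \<bb>\<close>, the natural one is
  \<open>S = \<ss>\<close>.\<close>

definition module_copy :: "('f^3^3 \<Rightarrow> 'g) \<Rightarrow> ('f^3^3) set \<Rightarrow> 'g set \<Rightarrow> bool"
  where "module_copy emb S V \<longleftrightarrow> (\<exists>f.
    linear_on S (mscale (*)) scale f \<and> bij_betw f S V \<and>
    (\<forall>p. \<forall>M\<in>S \<inter> gl_gr p. f M \<in> gr p) \<and>
    (\<forall>Z\<in>\<bb>. \<forall>M\<in>S. f (gl_bracket Z M) = br (emb Z) (f M)))"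

definition trivial_submodule :: "('f^3^3 \<Rightarrow> 'g) \<Rightarrow> 'g set \<Rightarrow> bool"
  where "trivial_submodule emb T \<longleftrightarrow>
    subspace T \<and> (\<forall>t\<in>T. \<exists>t0\<in>T \<inter> gr 0. \<exists>t1\<in>T \<inter> gr 1. t = t0 + t1) \<and>
    (\<forall>Z\<in>\<bb>. \<forall>t\<in>T. br (emb Z) t = 0)"

end

text \<open>The locale fixes the chosen copy of \<open>\<bb>\<close>. Only even copies of the adjoint and
  natural modules are admitted; the trivial part may have both parities.\<close>

locale strictly_B01_graded = lie_superalgebra scale gr br
  for scale :: "'f::field \<Rightarrow> 'g::ab_group_add \<Rightarrow> 'g" and gr br +
  fixes emb :: "'f^3^3 \<Rightarrow> 'g"
  assumes emb: "osp_embedding emb"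
    and module_decomposition: "\<exists>\<V> T.
      (\<forall>V\<in>\<V>. module_copy emb \<bb> V \<or> module_copy emb \<ss> V) \<and>
      trivial_submodule emb T \<and> internal_direct_sum scale (insert T \<V>)"

text \<open>$\mathfrak{gl}(1,2) \otimes A$ is realised as the space of 3 by 3 matrices over the vector
  space $A$; for a subspace $S$ of $\mathfrak{gl}(1,2)$, $S \otimes A$ is the subspace of it spanned
  by the pure tensors.\<close>

definition tens :: "('f \<Rightarrow> 'a \<Rightarrow> 'a) \<Rightarrow> 'f^3^3 \<Rightarrow> 'a \<Rightarrow> 'a^3^3"
  where "tens s M a = (\<chi> i j. s (M $ i $ j) a)"

definition tensor_space ::
  "('f::field \<Rightarrow> 'a::ab_group_add \<Rightarrow> 'a) \<Rightarrow> ('f^3^3) set \<Rightarrow> ('a^3^3) set"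
  where "tensor_space s S = module.span (mscale s) {tens s M a |M a. M \<in> S}"

text \<open>The types \<open>'a\<close> and \<open>'b\<close> are the vector spaces $\mathcal{A}$ and $\mathcal{B}$, \<open>unit\<close> is the
  distinguished element $1$ of $\mathcal{A}$, and \<open>\<alpha>\<close>, \<open>\<beta>\<close> identify
  $\mathfrak{b} \otimes \mathcal{A}$ and $\mathfrak{s} \otimes \mathcal{B}$ with subspaces of the
  superalgebra. That $\mathcal{A}$ and $\mathcal{B}$ are purely even means that the parity of
  $M \otimes a$ is that of $M$.\<close>

locale B01_decomposition = strictly_B01_graded scale gr br emb
  for scale :: "'f::field \<Rightarrow> 'g::ab_group_add \<Rightarrow> 'g" and gr br emb +
  fixes scaleA :: "'f \<Rightarrow> 'a::ab_group_add \<Rightarrow> 'a"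
    and unit :: 'a
    and scaleB :: "'f \<Rightarrow> 'b::ab_group_add \<Rightarrow> 'b"
    and \<alpha> :: "'a^3^3 \<Rightarrow> 'g"
    and \<beta> :: "'b^3^3 \<Rightarrow> 'g"
    and D :: "'g set"
  assumes vector_space_A: "vector_space scaleA"
    and vector_space_B: "vector_space scaleB"
    and linear_\<alpha>: "linear_on (tensor_space scaleA \<bb>) (mscale scaleA) scale \<alpha>"
    and linear_\<beta>: "linear_on (tensor_space scaleB \<ss>) (mscale scaleB) scale \<beta>"
    and D_centralizer: "D = {d. \<forall>Z\<in>\<bb>. br (\<alpha> (tens scaleA Z unit)) d = 0}"
    and direct_sum: "bij_betw (\<lambda>(u, v, d). \<alpha> u + \<beta> v + d)
          (tensor_space scaleA \<bb> \<times> tensor_space scaleB \<ss> \<times> D) UNIV"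
    and gr_\<alpha>: "M \<in> \<bb> \<inter> gl_gr p \<Longrightarrow> \<alpha> (tens scaleA M a) \<in> gr p"
    and gr_\<beta>: "M \<in> \<ss> \<inter> gl_gr p \<Longrightarrow> \<beta> (tens scaleB M b) \<in> gr p"
    and emb_eq: "Z \<in> \<bb> \<Longrightarrow> emb Z = \<alpha> (tens scaleA Z unit)"
    and br_\<alpha>: "\<lbrakk>Z \<in> \<bb>; M \<in> \<bb>\<rbrakk> \<Longrightarrow>
          br (\<alpha> (tens scaleA Z unit)) (\<alpha> (tens scaleA M a)) = \<alpha> (tens scaleA (gl_bracket Z M) a)"
    and br_\<beta>: "\<lbrakk>Z \<in> \<bb>; M \<in> \<ss>\<rbrakk> \<Longrightarrow>
          br (\<alpha> (tens scaleA Z unit)) (\<beta> (tens scaleB M b)) = \<beta> (tens scaleB (gl_bracket Z M) b)"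

text \<open>The extension of \<open>Phi_gl\<close> to the superalgebra. It is determined uniquely by these
  conditions; that it is an automorphism is a consequence and not part of the definition.\<close>

definition (in B01_decomposition) is_Phi_extension :: "('g \<Rightarrow> 'g) \<Rightarrow> bool"
  where "is_Phi_extension \<Phi> \<longleftrightarrow>
    Vector_Spaces.linear scale scale \<Phi> \<and>
    (\<forall>M\<in>\<bb>. \<forall>a. \<Phi> (\<alpha> (tens scaleA M a)) = \<alpha> (tens scaleA (Phi_gl M) a)) \<and>
    (\<forall>M\<in>\<ss>. \<forall>b. \<Phi> (\<beta> (tens scaleB M b)) = \<beta> (tens scaleB (Phi_gl M) b)) \<and>
    (\<forall>d\<in>D. \<Phi> d = d)"

definition (in lie_superalgebra) graded_piece :: "'g \<Rightarrow> int \<Rightarrow> 'g set"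
  where "graded_piece h i = {z. br h z = scale (of_int i) z}"

definition (in lie_superalgebra) Phi_triple :: "('g \<Rightarrow> 'g) \<Rightarrow> 'g \<Rightarrow> 'g \<Rightarrow> 'g \<Rightarrow> 'g"
  where "Phi_triple \<Phi> x y z = br (br x (\<Phi> y)) z"


section \<open>$(-1,-1)$ Freudenthal-Kantor triple systems\<close>

definition triple_system ::
  "('f::field \<Rightarrow> 'v::ab_group_add \<Rightarrow> 'v) \<Rightarrow> 'v set \<Rightarrow> ('v \<Rightarrow> 'v \<Rightarrow> 'v \<Rightarrow> 'v) \<Rightarrow> bool"
  where "triple_system s U t \<longleftrightarrow>
    vector_space s \<and> module.subspace s U \<and>
    (\<forall>x\<in>U. \<forall>y\<in>U. \<forall>z\<in>U. t x y z \<in> U) \<and>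
    (\<forall>y\<in>U. \<forall>z\<in>U. linear_on U s s (\<lambda>x. t x y z)) \<and>
    (\<forall>x\<in>U. \<forall>z\<in>U. linear_on U s s (\<lambda>y. t x y z)) \<and>
    (\<forall>x\<in>U. \<forall>y\<in>U. linear_on U s s (\<lambda>z. t x y z))"

definition FK_K :: "('v \<Rightarrow> 'v \<Rightarrow> 'v \<Rightarrow> 'v) \<Rightarrow> 'v \<Rightarrow> 'v \<Rightarrow> 'v \<Rightarrow> 'v::ab_group_add"
  where "FK_K t x y z = t x z y + t y z x"

text \<open>The operator $L(x,y)$ is \<open>t x y\<close>; the operator identities are stated on arguments \<open>z\<close> in \<open>U\<close>.\<close>

definition FK_triple_system ::
  "('f::field \<Rightarrow> 'v::ab_group_add \<Rightarrow> 'v) \<Rightarrow> 'v set \<Rightarrow> ('v \<Rightarrow> 'v \<Rightarrow> 'v \<Rightarrow> 'v) \<Rightarrow> bool"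
  where "FK_triple_system s U t \<longleftrightarrow> triple_system s U t \<and>
    (\<forall>u\<in>U. \<forall>v\<in>U. \<forall>x\<in>U. \<forall>y\<in>U. \<forall>z\<in>U.
      t u v (t x y z) - t x y (t u v z) = t (t u v x) y z - t x (t v u y) z \<and>
      FK_K t (FK_K t u v x) y z = t y x (FK_K t u v z) + FK_K t u v (t x y z))"

definition left_unit :: "'v set \<Rightarrow> ('v \<Rightarrow> 'v \<Rightarrow> 'v \<Rightarrow> 'v) \<Rightarrow> 'v \<Rightarrow> bool"
  where "left_unit U t e \<longleftrightarrow> e \<in> U \<and> (\<forall>x\<in>U. t e e x = x)"

end

theory Submission
  imports Defs
begin

text \<open>
  The automorphism \<open>\<Phi>\<close> enters the triple product only through its values on
  \<open>U\<close> $= \mathfrak{g}_1$, and there it coincides with the inner derivation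
  \<open>ad F\<close>: both send \<open>X \<otimes> a\<close> to \<open>Y \<otimes> a\<close> and \<open>Xhat \<otimes> b\<close> to \<open>Yhat \<otimes> b\<close>
  (\<open>Phi_extension_on_weight_1\<close>). So the triple product is \<open>xyz = [[x, [F, y]], z]\<close>, and its
  identities can be derived from the Leibniz rule for the even derivation \<open>ad F\<close>.

  The Freudenthal-Kantor identities then follow from three facts: every element of \<open>U\<close> is odd,
  \<open>(ad F)\<^sup>2\<close> kills \<open>U\<close>, and \<open>[[U, U], U] = 0\<close>. Applying \<open>(ad F)\<^sup>2\<close> to \<open>[[x, y], z] = 0\<close> and
  dividing by 2 gives \<open>[F, xyz] = - [[y, [F, x]], [F, z]]\<close> (\<open>lower_triple\<close>). This is the compatibility
  of \<open>L(x,y)\<close> with \<open>ad F\<close> that turns the Jacobi identity for the even elements \<open>[x, [F, y]]\<close> into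
  the first identity. For the second one, the super Jacobi identity shows
  \<open>K(u,v)x = - [[u, v], [F, x]]\<close> (\<open>K_eq\<close>), and the identity reduces to the Leibniz rule once more.
  All this is carried out in the locale \<open>lowering_pair\<close>, which retains just these properties of
  the pair \<open>(H, F)\<close>.

  The three facts come from the weights of \<open>ad H\<close>: \<open>2, -2, 1, -1, 0\<close> on the copies of
  \<open>E, F, X, Y, H\<close>, and \<open>1, -1, 0\<close> on those of \<open>Xhat, Yhat, Hhat\<close>, and \<open>0\<close> on \<open>D\<close>. In characteristic
  other than two and three the vectors of weight 1 are therefore exactly
  \<open>X \<otimes> a + Xhat \<otimes> b\<close> (\<open>weight_1_cases\<close>). The elements \<open>[[x, y], z]\<close> have weight 3. In
  characteristic five \<open>3 = -2\<close>, so that vectors \<open>F \<otimes> a\<close> of weight 3 exist; but they are even,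
  while \<open>[[x, y], z]\<close> is odd.

  Finally, \<open>e = X \<otimes> 1\<close> is a left unit because \<open>[e, [F, e]] = [X, Y] \<otimes> 1 = H \<otimes> 1\<close> acts on \<open>U\<close> as
  the identity, and \<open>exe = x\<close> is checked on \<open>X \<otimes> a\<close> and \<open>Xhat \<otimes> b\<close> by matrix computation.
\<close>

section \<open>Brackets with homogeneous elements\<close>

context lie_superalgebra
begin

lemma br_add_left: "br (x + y) z = br x z + br y z"
  and br_scale_left: "br (scale c x) z = scale c (br x z)"
  using linear_br_left[of z]
  unfolding Vector_Spaces.linear_def module_hom_def module_hom_axioms_def by blast+

lemma br_add_right: "br x (y + z) = br x y + br x z"
  and br_scale_right: "br x (scale c z) = scale c (br x z)"
  using linear_br_right[of x]
  unfolding Vector_Spaces.linear_def module_hom_def module_hom_axioms_def by blast+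

lemma br_zero_left: "br 0 z = 0"
  using br_scale_left[of 0 0 z] by simp

lemma br_zero_right: "br z 0 = 0"
  using br_scale_right[of z 0 0] by simp

lemma br_minus_left: "br (- x) z = - br x z"
  using br_scale_left[of "-1" x z] by simp

lemma br_minus_right: "br x (- z) = - br x z"
  using br_scale_right[of x "-1" z] by simp

lemma br_diff_right: "br x (y - z) = br x y - br x z"
  using br_add_right[of x y "- z"] by (simp add: br_minus_right)

lemmas br_linear_simps = br_add_left br_scale_left br_add_right br_scale_right
  br_zero_left br_zero_right br_minus_left br_minus_right br_diff_right

text \<open>If one factor is even, the signs disappear for homogeneous second factors, hence for all of
  them. This spares parity conditions on the remaining arguments, here and in the Leibniz rule
  below.\<close>

lemma br_even_skew:
  assumes "x \<in> gr 0"
  shows "br y x = - br x y"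
proof -
  obtain y0 y1 where y: "y0 \<in> gr 0" "y1 \<in> gr 1" "y = y0 + y1" using gr_sum by blast
  show ?thesis
    using br_super_skew[OF y(1) assms] br_super_skew[OF y(2) assms]
    by (simp add: y(3) br_linear_simps koszul_def)
qed

lemma br_odd_symmetric: "\<lbrakk>x \<in> gr 1; y \<in> gr 1\<rbrakk> \<Longrightarrow> br x y = br y x"
  using br_super_skew[of x 1 y 1] by (simp add: koszul_def)

lemma br_even_derivation:
  assumes "x \<in> gr 0"
  shows "br x (br y z) = br (br x y) z + br y (br x z)"
proof -
  obtain y0 y1 where y: "y0 \<in> gr 0" "y1 \<in> gr 1" "y = y0 + y1" using gr_sum by blast
  show ?thesis
    using br_super_jacobi[OF assms y(1), of z] br_super_jacobi[OF assms y(2), of z]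
    by (simp add: y(3) br_linear_simps koszul_def)
qed

lemma br_odd_odd: "\<lbrakk>x \<in> gr 1; y \<in> gr 1\<rbrakk> \<Longrightarrow> br x y \<in> gr 0"
  using br_gr[of x 1 y 1] by simp

lemma br_even_odd: "\<lbrakk>x \<in> gr 0; y \<in> gr 1\<rbrakk> \<Longrightarrow> br x y \<in> gr 1"
  using br_gr[of x 0 y 1] by simp

lemma subspace_graded_piece: "subspace (graded_piece h i)"
  by (rule subspaceI)
    (auto simp: graded_piece_def br_linear_simps scale_right_distrib mult.commute)

lemma br_graded_piece:
  assumes "h \<in> gr 0" "x \<in> graded_piece h i" "y \<in> graded_piece h j"
  shows "br x y \<in> graded_piece h (i + j)"
  using assms br_even_derivation[OF assms(1), of x y]
  by (simp add: graded_piece_def br_linear_simps scale_left_distrib)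

end

section \<open>Freudenthal-Kantor triple systems from a lowering operator\<close>

text \<open>An abstraction of the pair \<open>(H, F)\<close>. The last condition is confined to odd vectors
  because weights are elements of the field: in characteristic five the weight spaces 3 and -2 are
  equal, and the latter contains the even vector \<open>f\<close>.\<close>

locale lowering_pair = lie_superalgebra scale gr br
  for scale :: "'f::field \<Rightarrow> 'g::ab_group_add \<Rightarrow> 'g" and gr br +
  fixes h f :: 'g
  assumes two_neq_0: "(2::'f) \<noteq> 0"
    and h_even: "h \<in> gr 0"
    and f_even: "f \<in> gr 0"
    and f_weight: "f \<in> graded_piece h (-2)"
    and weight_1_odd: "graded_piece h 1 \<subseteq> gr 1"
    and lower_twice: "y \<in> graded_piece h 1 \<Longrightarrow> br f (br f y) = 0"
    and no_odd_weight_3: "\<lbrakk>z \<in> graded_piece h 3; z \<in> gr 1\<rbrakk> \<Longrightarrow> z = 0"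
begin

abbreviation U :: "'g set" where "U \<equiv> graded_piece h 1"

lemma U_odd: "x \<in> U \<Longrightarrow> x \<in> gr 1"
  using weight_1_odd by blast

lemma lower_weight: "y \<in> U \<Longrightarrow> br f y \<in> graded_piece h (-1)"
  using br_graded_piece[OF h_even f_weight] by force

lemma lower_odd: "y \<in> U \<Longrightarrow> br f y \<in> gr 1"
  using br_even_odd f_even U_odd by blast

lemma L_even: "\<lbrakk>x \<in> U; y \<in> U\<rbrakk> \<Longrightarrow> br x (br f y) \<in> gr 0"
  using br_odd_odd lower_odd U_odd by blast

lemma triple_closed:
  assumes "x \<in> U" "y \<in> U" "z \<in> U"
  shows "br (br x (br f y)) z \<in> U"
proof -
  have "br x (br f y) \<in> graded_piece h (1 + - 1)"
    using assms lower_weight br_graded_piece[OF h_even] by blast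
  from br_graded_piece[OF h_even this assms(3)] show ?thesis by simp
qed

lemma br_triple_zero:
  assumes "x \<in> U" "y \<in> U" "z \<in> U"
  shows "br (br x y) z = 0"
proof (rule no_odd_weight_3)
  have "br x y \<in> graded_piece h (1 + 1)"
    using assms br_graded_piece[OF h_even] by blast
  from br_graded_piece[OF h_even this assms(3)] show "br (br x y) z \<in> graded_piece h 3" by simp
  show "br (br x y) z \<in> gr 1"
    using assms U_odd br_odd_odd br_even_odd by blast
qed

text \<open>Put \<open>w = [x, y]\<close>. Then \<open>[w, z] = 0\<close>, and expanding \<open>(ad f)\<^sup>2 [w, z] = 0\<close> by the Leibniz rule, where
  \<open>(ad f)\<^sup>2 w = 2 [[f, x], [f, y]]\<close> and \<open>(ad f)\<^sup>2 z = 0\<close>, expresses \<open>[[[f, x], [f, y]], z]\<close> through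
  \<open>[[f, w], [f, z]]\<close>. It says that \<open>ad f\<close> intertwines \<open>L(x,y)\<close> on weight 1 with \<open>- ad [y, [f, x]]\<close>
  on weight -1.\<close>

lemma lower_triple:
  assumes x: "x \<in> U" and y: "y \<in> U" and z: "z \<in> U"
  shows "br f (br (br x (br f y)) z) = - br (br y (br f x)) (br f z)"
proof -
  note der = br_even_derivation[OF f_even]
  have sym: "br (br f y) (br f x) = br (br f x) (br f y)" "br (br f x) y = br y (br f x)"
    using x y U_odd lower_odd br_odd_symmetric by auto
  have w1: "br f (br x y) = br y (br f x) + br x (br f y)"
    using der[of x y] sym by simp
  have w2: "br f (br f (br x y)) = br (br f x) (br f y) + br (br f x) (br f y)"
    by (simp add: w1 br_linear_simps der[of x "br f y"] der[of y "br f x"]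
        lower_twice[OF x] lower_twice[OF y] sym)
  have "0 = br f (br f (br (br x y) z))"
    using br_triple_zero[OF x y z] by (simp add: br_zero_right)
  also have "\<dots> = scale 2 (br (br (br f x) (br f y)) z + br (br f (br x y)) (br f z))"
    using lower_twice[OF z]
    by (simp add: der[of "br x y" z] der[of "br f (br x y)" z] der[of "br x y" "br f z"] w2
        br_linear_simps scale_left_distrib[of 1 1, simplified] scale_right_distrib)
  finally have "br (br (br f x) (br f y)) z = - br (br f (br x y)) (br f z)"
    using two_neq_0 by (simp add: eq_neg_iff_add_eq_0)
  then show ?thesis
    by (simp add: der[of "br x (br f y)" z] der[of x "br f y"] lower_twice[OF y] w1
        br_linear_simps)
qed

text \<open>The super Jacobi identity for the odd elements \<open>u\<close>, \<open>v\<close>, with both outer brackets turned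
  around. It factors \<open>K(u,v)\<close> as \<open>- ad [u, v]\<close> after \<open>ad f\<close>.\<close>

lemma K_eq:
  assumes u: "u \<in> U" and v: "v \<in> U" and x: "x \<in> U"
  shows "br (br u (br f x)) v + br (br v (br f x)) u = - br (br u v) (br f x)"
proof -
  have "br u (br v (br f x)) = br (br u v) (br f x) - br v (br u (br f x))"
    using br_super_jacobi[OF U_odd[OF u] U_odd[OF v]] by (simp add: koszul_def)
  moreover have "br u (br v (br f x)) = - br (br v (br f x)) u"
    "br v (br u (br f x)) = - br (br u (br f x)) v"
    using br_even_skew L_even u v x by auto
  ultimately show ?thesis by (simp add: neg_eq_iff_add_eq_0 eq_neg_iff_add_eq_0 ac_simps)
qed

theorem FK_triple_system_weight_1:
  assumes \<Phi>: "\<And>y. y \<in> U \<Longrightarrow> \<Phi> y = br f y"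
  shows "FK_triple_system scale U (Phi_triple \<Phi>)"
proof -
  have t: "Phi_triple \<Phi> x y z = br (br x (br f y)) z" if "y \<in> U" for x y z
    using that by (simp add: Phi_triple_def \<Phi>)
  note closed = triple_closed
  have add: "x + y \<in> U" and sc: "scale c x \<in> U" if "x \<in> U" "y \<in> U" for x y c
    using that subspace_graded_piece[of h 1] by (auto dest: subspace_add subspace_scale)
  have ts: "triple_system scale U (Phi_triple \<Phi>)"
    unfolding triple_system_def linear_on_def
    by (auto simp: t closed add sc br_linear_simps subspace_graded_piece
        intro: vector_space_axioms)
  have inner: "Phi_triple \<Phi> u v (Phi_triple \<Phi> x y z) - Phi_triple \<Phi> x y (Phi_triple \<Phi> u v z)
      = Phi_triple \<Phi> (Phi_triple \<Phi> u v x) y z - Phi_triple \<Phi> x (Phi_triple \<Phi> v u y) z"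
    if U: "u \<in> U" "v \<in> U" "x \<in> U" "y \<in> U" "z \<in> U" for u v x y z
  proof -
    \<comment> \<open>\<open>ad [u, [f, v]]\<close> acts on the weight -1 factor \<open>[f, y]\<close> as \<open>- ad f\<close> after \<open>L(v,u)\<close>.\<close>
    have "br (br u (br f v)) (br x (br f y)) =
        br (br (br u (br f v)) x) (br f y) - br x (br f (br (br v (br f u)) y))"
      using br_even_derivation[OF L_even[OF U(1,2)], of x "br f y"] lower_triple[OF U(2,1,4)]
      by (simp add: br_linear_simps)
    moreover have "br (br u (br f v)) (br (br x (br f y)) z) =
        br (br (br u (br f v)) (br x (br f y))) z + br (br x (br f y)) (br (br u (br f v)) z)"
      by (rule br_even_derivation[OF L_even[OF U(1,2)]])
    ultimately show ?thesis
      by (simp add: t U closed br_linear_simps diff_conv_add_uminus del: add_uminus_conv_diff)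
  qed
  have outer: "FK_K (Phi_triple \<Phi>) (FK_K (Phi_triple \<Phi>) u v x) y z
      = Phi_triple \<Phi> y x (FK_K (Phi_triple \<Phi>) u v z) + FK_K (Phi_triple \<Phi>) u v (Phi_triple \<Phi> x y z)"
    if U: "u \<in> U" "v \<in> U" "x \<in> U" "y \<in> U" "z \<in> U" for u v x y z
  proof -
    let ?w = "br u v"
    have K: "FK_K (Phi_triple \<Phi>) a b c = - br (br a b) (br f c)"
      if "a \<in> U" "b \<in> U" "c \<in> U" for a b c
      using that K_eq by (simp add: FK_K_def t)
    have w_even: "?w \<in> gr 0" using U U_odd br_odd_odd by blast
    have KU: "- br ?w (br f x) \<in> U"
      using K_eq[OF U(1,2,3)] add closed U by metis
    have "br ?w (br f x) \<in> gr 1" using br_even_odd[OF w_even] lower_odd U by blast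
    \<comment> \<open>Leibniz rule for the even element \<open>[u, v]\<close>, which annihilates \<open>y\<close>.\<close>
    then have "br (br ?w (br f x)) y = br ?w (br y (br f x))"
      using br_even_derivation[OF w_even, of y "br f x"] br_triple_zero[OF U(1,2,4)]
        br_odd_symmetric U_odd U by (simp add: br_linear_simps)
    then have wxy: "br (br ?w (br f x)) y = - br (br y (br f x)) ?w"
      using br_even_skew L_even U by metis
    have "FK_K (Phi_triple \<Phi>) (FK_K (Phi_triple \<Phi>) u v x) y z
        = - br (br (br y (br f x)) ?w) (br f z)"
      by (simp add: K U KU br_linear_simps wxy)
    also have "\<dots> = br ?w (br (br y (br f x)) (br f z)) - br (br y (br f x)) (br ?w (br f z))"
      using br_even_derivation[OF L_even[OF U(4,3)], of ?w "br f z"] by simp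
    also have "\<dots> = Phi_triple \<Phi> y x (FK_K (Phi_triple \<Phi>) u v z)
        + FK_K (Phi_triple \<Phi>) u v (Phi_triple \<Phi> x y z)"
      by (simp add: K U t closed lower_triple br_linear_simps)
    finally show ?thesis .
  qed
  show ?thesis
    using ts inner outer by (simp add: FK_triple_system_def)
qed

end

section \<open>Tensoring a span of matrices with a vector space\<close>

lemma vector_space_mscale:
  assumes "vector_space s"
  shows "vector_space (mscale s)"
proof -
  interpret vector_space s by fact
  show ?thesis
    by unfold_locales
      (simp_all add: mscale_def vec_eq_iff scale_right_distrib scale_left_distrib)
qed

interpretation gl: vector_space "mscale (*) :: 'f::field \<Rightarrow> 'f^3^3 \<Rightarrow> 'f^3^3"
  by (rule vector_space_mscale, unfold_locales) (simp_all add: algebra_simps)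

context vector_space
begin

interpretation mat: vector_space "mscale scale :: 'a \<Rightarrow> 'b^3^3 \<Rightarrow> 'b^3^3"
  by (rule vector_space_mscale) (rule vector_space_axioms)

lemma tens_add_left: "tens scale (M + N) a = tens scale M a + tens scale N a"
  and tens_scale_left: "tens scale (mscale (*) c M) a = mscale scale c (tens scale M a)"
  and tens_zero_left: "tens scale 0 a = 0"
  and tens_add_right: "tens scale M (a + b) = tens scale M a + tens scale M b"
  and tens_scale_right: "tens scale M (scale c a) = mscale scale c (tens scale M a)"
  and tens_zero_right: "tens scale M 0 = 0"
  by (simp_all add: tens_def mscale_def vec_eq_iff scale_left_distrib scale_right_distrib
      mult.commute)

lemma tens_in_tensor_space: "M \<in> S \<Longrightarrow> tens scale M a \<in> tensor_space scale S"
  unfolding tensor_space_def by (rule mat.span_base) blast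

lemma tensor_space_add:
    "\<lbrakk>u \<in> tensor_space scale S; v \<in> tensor_space scale S\<rbrakk> \<Longrightarrow> u + v \<in> tensor_space scale S"
  and tensor_space_scale: "u \<in> tensor_space scale S \<Longrightarrow> mscale scale c u \<in> tensor_space scale S"
  and tensor_space_zero: "0 \<in> tensor_space scale S"
  unfolding tensor_space_def by (rule mat.span_add mat.span_scale mat.span_zero; assumption)+

lemma tensor_space_trivial: "tensor_space scale {0} = {0}"
proof -
  have "{tens scale M a |M a. M \<in> {0}} = {0}"
    by (auto simp: tens_zero_left)
  then show ?thesis
    by (simp add: tensor_space_def mat.span_insert_0)
qed

text \<open>Peels one generator off a span. Applied repeatedly, it writes an element of the tensor product
  of a span of matrices with a vector space as a sum of one pure tensor per generator.\<close>

lemma tensor_space_span_insert: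
  assumes "v \<in> tensor_space scale (gl.span (insert M S))"
  shows "\<exists>a. \<exists>v'\<in>tensor_space scale (gl.span S). v = tens scale M a + v'"
  using assms unfolding tensor_space_def[of scale "gl.span (insert M S)"]
proof (induction rule: mat.span_induct_alt)
  case base
  have "(0 :: 'b^3^3) = tens scale M 0 + 0" by (simp add: tens_zero_right)
  then show ?case using tensor_space_zero by blast
next
  case (step c x y)
  then obtain N a where N: "N \<in> gl.span (insert M S)" "x = tens scale N a" by blast
  from N(1) obtain k where k: "N - mscale (*) k M \<in> gl.span S"
    using gl.span_breakdown_eq by blast
  have "N = mscale (*) k M + (N - mscale (*) k M)" by simp
  then have x: "x = tens scale M (scale k a) + tens scale (N - mscale (*) k M) a"
    using N(2) by (metis tens_add_left tens_scale_left tens_scale_right)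
  from step.IH obtain b v' where y: "v' \<in> tensor_space scale (gl.span S)" "y = tens scale M b + v'"
    by blast
  have "mscale scale c x + y = tens scale M (scale c (scale k a) + b)
      + (mscale scale c (tens scale (N - mscale (*) k M) a) + v')"
    by (simp add: x y(2) tens_add_right tens_scale_right mat.scale_right_distrib)
  then show ?case
    using tensor_space_add[OF tensor_space_scale[OF tens_in_tensor_space[OF k]] y(1)] by blast
qed

end

section \<open>Computations in $\mathfrak{gl}(1,2)$\<close>

lemma mat_unit_nth: "mat_unit i j $ k $ l = (if k = i \<and> l = j then 1 else 0)"
  by (simp add: mat_unit_def axis_def)

lemmas mat_defs = mat_H_def mat_E_def mat_F_def mat_X_def mat_Y_def mat_Hhat_def mat_Xhat_def
  mat_Yhat_def

lemmas mat_compute = gl_bracket_def mat_defs mat_unit_nth mscale_def gl_part_def index_parity_def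
  koszul_def matrix_matrix_mult_def vec_eq_iff forall_3 sum_3

lemma bracket_mat_H:
  "gl_bracket mat_H mat_H = (0 :: 'f::field^3^3)"
  "gl_bracket mat_H mat_E = (mscale (*) 2 mat_E :: 'f^3^3)"
  "gl_bracket mat_H mat_F = (mscale (*) (-2) mat_F :: 'f^3^3)"
  "gl_bracket mat_H mat_X = (mat_X :: 'f^3^3)"
  "gl_bracket mat_H mat_Y = (mscale (*) (-1) mat_Y :: 'f^3^3)"
  "gl_bracket mat_H mat_Hhat = (0 :: 'f^3^3)"
  "gl_bracket mat_H mat_Xhat = (mat_Xhat :: 'f^3^3)"
  "gl_bracket mat_H mat_Yhat = (mscale (*) (-1) mat_Yhat :: 'f^3^3)"
  by (simp_all add: mat_compute)

lemma bracket_mat_F: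
  "gl_bracket mat_F mat_X = (mat_Y :: 'f::field^3^3)"
  "gl_bracket mat_F mat_Y = (0 :: 'f^3^3)"
  "gl_bracket mat_F mat_Xhat = (mat_Yhat :: 'f^3^3)"
  "gl_bracket mat_F mat_Yhat = (0 :: 'f^3^3)"
  by (simp_all add: mat_compute)

lemma bracket_mat_X:
  "gl_bracket mat_X mat_H = (mscale (*) (-1) mat_X :: 'f::field^3^3)"
  "gl_bracket mat_X mat_Y = (mat_H :: 'f^3^3)"
  "gl_bracket mat_X mat_Hhat = (mat_Xhat :: 'f^3^3)"
  "gl_bracket mat_X mat_Yhat = (mscale (*) (-1) mat_Hhat :: 'f^3^3)"
  by (simp_all add: mat_compute)

lemma mat_parity:
  "mat_H \<in> gl_gr 0" "mat_F \<in> gl_gr 0" "mat_X \<in> gl_gr 1" "mat_Xhat \<in> gl_gr 1"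
  by (simp_all add: gl_gr_def mat_compute)

lemma mat_in_\<bb>:
  "mat_H \<in> \<bb>" "mat_E \<in> \<bb>" "mat_F \<in> \<bb>" "mat_X \<in> \<bb>" "mat_Y \<in> \<bb>"
  by (simp_all add: \<bb>_def gl.span_base)

lemma mat_in_\<ss>: "mat_Hhat \<in> \<ss>" "mat_Xhat \<in> \<ss>" "mat_Yhat \<in> \<ss>"
  by (simp_all add: \<ss>_def gl.span_base)

text \<open>The inverse of \<open>Phi_mat\<close> is exhibited only to see that \<open>matrix_inv\<close>, a choice among inverses,
  is one.\<close>

lemma Phi_gl_eqI:
  assumes "Phi_mat ** M = N ** (Phi_mat :: 'f::field^3^3)"
  shows "Phi_gl M = N"
proof -
  let ?Q = "vector [vector [1, 0, 0], vector [0, 0, 1], vector [0, -1, 0]] :: 'f^3^3"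
  have "Phi_mat ** ?Q = mat 1 \<and> ?Q ** Phi_mat = mat 1"
    by (simp add: Phi_mat_def mat_def matrix_matrix_mult_def vec_eq_iff forall_3 sum_3)
  then have "Phi_mat ** matrix_inv (Phi_mat :: 'f^3^3) = mat 1"
    unfolding matrix_inv_def by (rule someI2) blast
  then show ?thesis
    by (simp add: Phi_gl_def assms flip: matrix_mul_assoc)
qed

lemma Phi_gl_mat_X: "Phi_gl mat_X = (mat_Y :: 'f::field^3^3)"
  and Phi_gl_mat_Xhat: "Phi_gl mat_Xhat = (mat_Yhat :: 'f::field^3^3)"
  by (rule Phi_gl_eqI, simp add: Phi_mat_def mat_compute)+

section \<open>Weight spaces of a strictly $B(0,1)$-graded Lie superalgebra\<close>

context B01_decomposition
begin

interpretation A: vector_space scaleA by (rule vector_space_A)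
interpretation B: vector_space scaleB by (rule vector_space_B)

abbreviation tA :: "'f^3^3 \<Rightarrow> 'a \<Rightarrow> 'g" where "tA M a \<equiv> \<alpha> (tens scaleA M a)"
abbreviation tB :: "'f^3^3 \<Rightarrow> 'b \<Rightarrow> 'g" where "tB M b \<equiv> \<beta> (tens scaleB M b)"

lemma \<alpha>_add: "\<lbrakk>u \<in> tensor_space scaleA \<bb>; v \<in> tensor_space scaleA \<bb>\<rbrakk> \<Longrightarrow> \<alpha> (u + v) = \<alpha> u + \<alpha> v"
  and \<alpha>_scale: "u \<in> tensor_space scaleA \<bb> \<Longrightarrow> \<alpha> (mscale scaleA c u) = scale c (\<alpha> u)"
  using linear_\<alpha> unfolding linear_on_def by blast+

lemma \<beta>_add: "\<lbrakk>u \<in> tensor_space scaleB \<ss>; v \<in> tensor_space scaleB \<ss>\<rbrakk> \<Longrightarrow> \<beta> (u + v) = \<beta> u + \<beta> v"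
  and \<beta>_scale: "u \<in> tensor_space scaleB \<ss> \<Longrightarrow> \<beta> (mscale scaleB c u) = scale c (\<beta> u)"
  using linear_\<beta> unfolding linear_on_def by blast+

lemma \<alpha>_zero: "\<alpha> 0 = 0"
  using \<alpha>_add[OF A.tensor_space_zero A.tensor_space_zero] by simp

lemma \<beta>_zero: "\<beta> 0 = 0"
  using \<beta>_add[OF B.tensor_space_zero B.tensor_space_zero] by simp

lemma tA_scale: "M \<in> \<bb> \<Longrightarrow> tA (mscale (*) c M) a = scale c (tA M a)"
  by (simp add: A.tens_scale_left \<alpha>_scale A.tens_in_tensor_space)

lemma tB_scale: "M \<in> \<ss> \<Longrightarrow> tB (mscale (*) c M) b = scale c (tB M b)"
  by (simp add: B.tens_scale_left \<beta>_scale B.tens_in_tensor_space)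

lemma br_tA:
  "br (tA mat_H unit) (tA mat_H a) = 0"
  "br (tA mat_H unit) (tA mat_E a) = scale 2 (tA mat_E a)"
  "br (tA mat_H unit) (tA mat_F a) = scale (-2) (tA mat_F a)"
  "br (tA mat_H unit) (tA mat_X a) = tA mat_X a"
  "br (tA mat_H unit) (tA mat_Y a) = scale (-1) (tA mat_Y a)"
  "br (tA mat_F unit) (tA mat_X a) = tA mat_Y a"
  "br (tA mat_F unit) (tA mat_Y a) = 0"
  "br (tA mat_X unit) (tA mat_H a) = scale (-1) (tA mat_X a)"
  "br (tA mat_X unit) (tA mat_Y a) = tA mat_H a"
  by (simp_all only: br_\<alpha> mat_in_\<bb> bracket_mat_H bracket_mat_F bracket_mat_X tA_scale
      A.tens_zero_left \<alpha>_zero)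

lemma br_tB:
  "br (tA mat_H unit) (tB mat_Hhat b) = 0"
  "br (tA mat_H unit) (tB mat_Xhat b) = tB mat_Xhat b"
  "br (tA mat_H unit) (tB mat_Yhat b) = scale (-1) (tB mat_Yhat b)"
  "br (tA mat_F unit) (tB mat_Xhat b) = tB mat_Yhat b"
  "br (tA mat_F unit) (tB mat_Yhat b) = 0"
  "br (tA mat_X unit) (tB mat_Hhat b) = tB mat_Xhat b"
  "br (tA mat_X unit) (tB mat_Yhat b) = scale (-1) (tB mat_Hhat b)"
  by (simp_all only: br_\<beta> mat_in_\<bb> mat_in_\<ss> bracket_mat_H bracket_mat_F bracket_mat_X tB_scale
      B.tens_zero_left \<beta>_zero)

lemma tensor_space_\<bb>_cases:
  assumes "u \<in> tensor_space scaleA \<bb>"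
  obtains aH aE aF aX aY where "u = tens scaleA mat_H aH + (tens scaleA mat_E aE
    + (tens scaleA mat_F aF + (tens scaleA mat_X aX + tens scaleA mat_Y aY)))"
  using assms unfolding \<bb>_def
  by (auto dest!: A.tensor_space_span_insert simp: A.tensor_space_trivial)

lemma tensor_space_\<ss>_cases:
  assumes "v \<in> tensor_space scaleB \<ss>"
  obtains bH bX bY where "v = tens scaleB mat_Hhat bH
    + (tens scaleB mat_Xhat bX + tens scaleB mat_Yhat bY)"
  using assms unfolding \<ss>_def
  by (auto dest!: B.tensor_space_span_insert simp: B.tensor_space_trivial)

text \<open>Each summand of the decomposition is an eigenvector of \<open>ad (H \<otimes> 1)\<close>, so for a vector of weight
  \<open>i\<close> only the components whose eigenvalue is \<open>i\<close> in the field survive. The three parts are separated by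
  directness of the sum, and the components within the first two by reading off matrix entries, each
  generator having an entry of its own: for instance (2,1) for \<open>X\<close> and (1,2) for \<open>Y\<close>.\<close>

lemma weight_vector_components:
  assumes z: "z \<in> graded_piece (tA mat_H unit) i"
  obtains aH aE aF aX aY bH bX bY d where
    "z = tA mat_H aH + (tA mat_E aE + (tA mat_F aF + (tA mat_X aX + tA mat_Y aY)))
       + (tB mat_Hhat bH + (tB mat_Xhat bX + tB mat_Yhat bY)) + d"
    "of_int i = (0::'f) \<or> aH = 0" "of_int i = (2::'f) \<or> aE = 0" "of_int i = (-2::'f) \<or> aF = 0"
    "of_int i = (1::'f) \<or> aX = 0" "of_int i = (-1::'f) \<or> aY = 0"
    "of_int i = (0::'f) \<or> bH = 0" "of_int i = (1::'f) \<or> bX = 0" "of_int i = (-1::'f) \<or> bY = 0"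
    "of_int i = (0::'f) \<or> d = 0"
proof -
  let ?c = "of_int i :: 'f"
  obtain u v d where uvd: "u \<in> tensor_space scaleA \<bb>" "v \<in> tensor_space scaleB \<ss>" "d \<in> D"
    and z_eq: "z = \<alpha> u + \<beta> v + d"
    using bij_betw_imp_surj_on[OF direct_sum] by (force simp: image_iff set_eq_iff)
  obtain aH aE aF aX aY where u: "u = tens scaleA mat_H aH + (tens scaleA mat_E aE
    + (tens scaleA mat_F aF + (tens scaleA mat_X aX + tens scaleA mat_Y aY)))"
    using tensor_space_\<bb>_cases[OF uvd(1)] .
  obtain bH bX bY where v: "v = tens scaleB mat_Hhat bH
    + (tens scaleB mat_Xhat bX + tens scaleB mat_Yhat bY)"
    using tensor_space_\<ss>_cases[OF uvd(2)] .
  define u' where "u' = mscale scaleA 2 (tens scaleA mat_E aE)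
    + (mscale scaleA (-2) (tens scaleA mat_F aF)
    + (tens scaleA mat_X aX + mscale scaleA (-1) (tens scaleA mat_Y aY)))"
  define v' where "v' = tens scaleB mat_Xhat bX + mscale scaleB (-1) (tens scaleB mat_Yhat bY)"
  note ts = A.tens_in_tensor_space B.tens_in_tensor_space mat_in_\<bb> mat_in_\<ss> A.tensor_space_add
    B.tensor_space_add A.tensor_space_scale B.tensor_space_scale
  note lin = \<alpha>_add \<alpha>_scale \<beta>_add \<beta>_scale
  have u': "u' \<in> tensor_space scaleA \<bb>" and v': "v' \<in> tensor_space scaleB \<ss>"
    by (simp_all add: u'_def v'_def ts)
  have d0: "br (tA mat_H unit) d = 0"
    using uvd(3) D_centralizer mat_in_\<bb>(1) by blast
  have cd: "scale ?c d \<in> D" and "0 \<in> D"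
    using uvd(3) by (auto simp: D_centralizer br_linear_simps)
  have "br (tA mat_H unit) z = \<alpha> u' + \<beta> v' + 0"
    by (simp add: z_eq u v u'_def v'_def lin ts br_linear_simps br_tA br_tB d0)
  moreover have "br (tA mat_H unit) z = \<alpha> (mscale scaleA ?c u) + \<beta> (mscale scaleB ?c v) + scale ?c d"
    using z uvd by (simp add: graded_piece_def z_eq lin scale_right_distrib)
  ultimately have "(\<lambda>(u, v, d). \<alpha> u + \<beta> v + d) (u', v', 0)
      = (\<lambda>(u, v, d). \<alpha> u + \<beta> v + d) (mscale scaleA ?c u, mscale scaleB ?c v, scale ?c d)"
    by simp
  then have "(u', v', 0) = (mscale scaleA ?c u, mscale scaleB ?c v, scale ?c d)"
    by (rule inj_onD[OF bij_betw_imp_inj_on[OF direct_sum]])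
      (simp_all add: u' v' ts uvd cd \<open>0 \<in> D\<close>)
  then have eqs: "u' = mscale scaleA ?c u" "v' = mscale scaleB ?c v" "scale ?c d = 0"
    by simp_all
  note entries = u v u'_def v'_def tens_def mat_compute
  have "scaleA ?c aH = scaleA 0 aH" "scaleA ?c aE = scaleA 2 aE" "scaleA ?c aF = scaleA (-2) aF"
    "scaleA ?c aX = scaleA 1 aX" "scaleA ?c aY = scaleA (-1) aY"
    using arg_cong[OF eqs(1)[symmetric], of "\<lambda>M. M $ 2 $ 2"]
      arg_cong[OF eqs(1)[symmetric], of "\<lambda>M. M $ 2 $ 3"]
      arg_cong[OF eqs(1)[symmetric], of "\<lambda>M. M $ 3 $ 2"]
      arg_cong[OF eqs(1)[symmetric], of "\<lambda>M. M $ 2 $ 1"]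
      arg_cong[OF eqs(1)[symmetric], of "\<lambda>M. M $ 1 $ 2"]
    by (simp_all add: entries)
  then have A_cases: "?c = 0 \<or> aH = 0" "?c = 2 \<or> aE = 0" "?c = -2 \<or> aF = 0"
    "?c = 1 \<or> aX = 0" "?c = -1 \<or> aY = 0"
    unfolding A.scale_cancel_right .
  have "scaleB ?c bH = scaleB 0 bH" "scaleB ?c bX = scaleB 1 bX" "scaleB ?c bY = scaleB (-1) bY"
    using arg_cong[OF eqs(2)[symmetric], of "\<lambda>M. M $ 2 $ 2"]
      arg_cong[OF eqs(2)[symmetric], of "\<lambda>M. M $ 2 $ 1"]
      arg_cong[OF eqs(2)[symmetric], of "\<lambda>M. M $ 3 $ 1"]
    by (simp_all add: entries)
  then have B_cases: "?c = 0 \<or> bH = 0" "?c = 1 \<or> bX = 0" "?c = -1 \<or> bY = 0"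
    unfolding B.scale_cancel_right .
  have "z = tA mat_H aH + (tA mat_E aE + (tA mat_F aF + (tA mat_X aX + tA mat_Y aY)))
       + (tB mat_Hhat bH + (tB mat_Xhat bX + tB mat_Yhat bY)) + d"
    by (simp add: z_eq u v lin ts)
  moreover have "?c = 0 \<or> d = 0" using eqs(3) by simp
  ultimately show ?thesis
    using A_cases B_cases by (intro that)
qed

lemma weight_1_cases:
  assumes "(2::'f) \<noteq> 0" "(3::'f) \<noteq> 0" "z \<in> graded_piece (tA mat_H unit) 1"
  obtains a b where "z = tA mat_X a + tB mat_Xhat b"
proof -
  have "(1::'f) - 2 = -1" "(1::'f) - (-2) = 3" "(1::'f) - (-1) = 2" by simp_all
  then have "(1::'f) \<noteq> 2" "(1::'f) \<noteq> -2" "(1::'f) \<noteq> -1"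
    using assms(1,2) by (metis right_minus_eq neg_equal_0_iff_equal zero_neq_one)+
  then show thesis
    by (cases rule: weight_vector_components[OF assms(3)], intro that)
      (simp add: A.tens_zero_right B.tens_zero_right \<alpha>_zero \<beta>_zero)
qed

text \<open>The vector \<open>a\<close> is zero unless the characteristic is five, where 3 and -2 are equal.\<close>

lemma weight_3_cases:
  assumes "(2::'f) \<noteq> 0" "(3::'f) \<noteq> 0" "z \<in> graded_piece (tA mat_H unit) 3"
  obtains a where "z = tA mat_F a"
proof -
  have "(3::'f) - 2 = 1" "(3::'f) - 1 = 2" "(3::'f) - (-1) = 2 * 2" by simp_all
  then have "(3::'f) \<noteq> 2" "(3::'f) \<noteq> 1" "(3::'f) \<noteq> -1"
    using assms(1,2) by (metis right_minus_eq mult_eq_0_iff zero_neq_one)+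
  with assms(2) show thesis
    by (cases rule: weight_vector_components[OF assms(3)], intro that)
      (simp add: A.tens_zero_right B.tens_zero_right \<alpha>_zero \<beta>_zero)
qed

text \<open>By \<open>[F, X] = Y\<close>, \<open>[F, Xhat] = Yhat\<close> and \<open>[F, Y] = [F, Yhat] = 0\<close>, two applications of
  \<open>ad (F \<otimes> 1)\<close> kill weight 1; and weight 3 contains nothing odd, since \<open>F \<otimes> a\<close> is even.\<close>

lemma lowering_pair_H_F:
  assumes "(2::'f) \<noteq> 0" "(3::'f) \<noteq> 0"
  shows "lowering_pair scale gr br (tA mat_H unit) (tA mat_F unit)"
proof unfold_locales
  show "(2::'f) \<noteq> 0" by fact
  show "tA mat_H unit \<in> gr 0" "tA mat_F unit \<in> gr 0"
    by (simp_all add: gr_\<alpha> mat_in_\<bb> mat_parity)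
  then have F_even: "tA mat_F a \<in> gr 0" for a
    by (simp add: gr_\<alpha> mat_in_\<bb> mat_parity)
  show "tA mat_F unit \<in> graded_piece (tA mat_H unit) (- 2)"
    by (simp add: graded_piece_def br_tA)
  show "graded_piece (tA mat_H unit) 1 \<subseteq> gr 1"
  proof
    fix x assume "x \<in> graded_piece (tA mat_H unit) 1"
    then obtain a b where "x = tA mat_X a + tB mat_Xhat b" using weight_1_cases assms by blast
    then show "x \<in> gr 1"
      by (simp add: subspace_add[OF subspace_gr] gr_\<alpha> gr_\<beta> mat_in_\<bb> mat_in_\<ss> mat_parity)
  qed
  show "br (tA mat_F unit) (br (tA mat_F unit) y) = 0" if "y \<in> graded_piece (tA mat_H unit) 1" for y
    by (cases rule: weight_1_cases[OF assms that]) (simp add: br_linear_simps br_tA br_tB)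
  show "z = 0" if z: "z \<in> graded_piece (tA mat_H unit) 3" "z \<in> gr 1" for z
  proof -
    obtain a where "z = tA mat_F a" using weight_3_cases[OF assms z(1)] .
    then show ?thesis using F_even z(2) gr_inter by auto
  qed
qed

lemma Phi_extension_on_weight_1:
  assumes "(2::'f) \<noteq> 0" "(3::'f) \<noteq> 0" "is_Phi_extension \<Phi>"
    and "y \<in> graded_piece (tA mat_H unit) 1"
  shows "\<Phi> y = br (tA mat_F unit) y"
proof -
  obtain a b where y: "y = tA mat_X a + tB mat_Xhat b"
    using weight_1_cases[OF assms(1,2,4)] .
  have "\<Phi> y = \<Phi> (tA mat_X a) + \<Phi> (tB mat_Xhat b)"
    using assms(3) unfolding y is_Phi_extension_def Vector_Spaces.linear_def module_hom_def
      module_hom_axioms_def by blast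
  also have "\<dots> = tA mat_Y a + tB mat_Yhat b"
    using assms(3) unfolding is_Phi_extension_def
    by (simp add: mat_in_\<bb> mat_in_\<ss> Phi_gl_mat_X Phi_gl_mat_Xhat)
  finally show ?thesis
    by (simp add: y br_linear_simps br_tA br_tB)
qed

lemma br_X_lower_X: "br (tA mat_X unit) (br (tA mat_F unit) (tA mat_X unit)) = tA mat_H unit"
  by (simp add: br_tA)

text \<open>The mechanism of \<open>exe = x\<close>: the operator \<open>ad X\<close> takes \<open>Y \<otimes> a\<close> to \<open>H \<otimes> a\<close> and this to
  \<open>- X \<otimes> a\<close>, and likewise \<open>Yhat \<otimes> b\<close> to \<open>- Hhat \<otimes> b\<close> and this to \<open>- Xhat \<otimes> b\<close>.\<close>

lemma br_X_br_X_lower: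
  assumes "(2::'f) \<noteq> 0" "(3::'f) \<noteq> 0" "x \<in> graded_piece (tA mat_H unit) 1"
  shows "br (tA mat_X unit) (br (tA mat_X unit) (br (tA mat_F unit) x)) = - x"
  by (cases rule: weight_1_cases[OF assms]) (simp add: br_linear_simps br_tA br_tB)

end

lemma of_nat_prime_neq_zero:
  assumes "prime p" "CHAR('f::field) \<noteq> p"
  shows "(of_nat p :: 'f) \<noteq> 0"
proof
  assume "(of_nat p :: 'f) = 0"
  then have "CHAR('f) dvd p" by (simp add: of_nat_eq_0_iff_char_dvd)
  then show False
    using assms CHAR_not_1' by (auto simp: prime_nat_iff)
qed

theorem theorem4p5:
  fixes scale :: "'f::field \<Rightarrow> 'g::ab_group_add \<Rightarrow> 'g"
    and gr :: "bit \<Rightarrow> 'g set"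
    and br :: "'g \<Rightarrow> 'g \<Rightarrow> 'g"
    and emb :: "'f^3^3 \<Rightarrow> 'g"
    and scaleA :: "'f \<Rightarrow> 'a::ab_group_add \<Rightarrow> 'a"
    and unit :: 'a
    and scaleB :: "'f \<Rightarrow> 'b::ab_group_add \<Rightarrow> 'b"
    and \<alpha> :: "'a^3^3 \<Rightarrow> 'g"
    and \<beta> :: "'b^3^3 \<Rightarrow> 'g"
    and D :: "'g set"
    and \<Phi> :: "'g \<Rightarrow> 'g"
  assumes char: "CHAR('f) \<noteq> 2" "CHAR('f) \<noteq> 3"
    and decomposition: "B01_decomposition scale gr br emb scaleA unit scaleB \<alpha> \<beta> D"
    and Phi: "B01_decomposition.is_Phi_extension scale scaleA scaleB \<alpha> \<beta> D \<Phi>"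
  defines "U \<equiv> lie_superalgebra.graded_piece scale br (\<alpha> (tens scaleA mat_H unit)) 1"
    and "triple \<equiv> lie_superalgebra.Phi_triple br \<Phi>"
    and "e \<equiv> \<alpha> (tens scaleA mat_X unit)"
  shows "FK_triple_system scale U triple \<and>
    left_unit U triple e \<and> (\<forall>x\<in>U. triple e x e = x)"
proof -
  have n: "(2::'f) \<noteq> 0" "(3::'f) \<noteq> 0"
    using of_nat_prime_neq_zero[OF two_is_prime_nat char(1)] of_nat_prime_neq_zero[of 3] char(2)
    by simp_all
  interpret B01_decomposition scale gr br emb scaleA unit scaleB \<alpha> \<beta> D by fact
  let ?h = "tA mat_H unit" and ?f = "tA mat_F unit"
  interpret lp: lowering_pair scale gr br ?h ?f
    by (rule lowering_pair_H_F[OF n])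
  note Phi_U = Phi_extension_on_weight_1[OF n Phi]
  have e: "e \<in> U"
    by (simp add: e_def U_def graded_piece_def br_tA)
  have "triple e e x = x" if "x \<in> U" for x
    using that e Phi_U br_X_lower_X
    by (simp add: triple_def Phi_triple_def e_def U_def graded_piece_def)
  moreover have "triple e x e = x" if "x \<in> U" for x
  proof -
    have "br e (br ?f x) \<in> gr 0"
      using e that lp.L_even by (simp add: U_def)
    then have "triple e x e = - br e (br e (br ?f x))"
      using that Phi_U br_even_skew by (simp add: triple_def Phi_triple_def U_def)
    then show ?thesis
      using that br_X_br_X_lower[OF n] by (simp add: e_def U_def)
  qed
  moreover have "FK_triple_system scale U triple"
    unfolding U_def triple_def by (rule lp.FK_triple_system_weight_1) (rule Phi_U)
  ultimately show ?thesis
    using e by (simp add: left_unit_def)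
qed

end
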